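(* Let $X$ be a topological space with Menger's property $\mathsf{S}_{\mathrm{fin}}(\mathrm{O},\mathrm{O})$. Then Alice does not have a winning strategy in Menger's game $\mathsf{G}_{\mathrm{fin}}(\mathrm{O},\mathrm{O})$ played on $X$.
   Context: An open cover of $X$ is a family of open subsets of $X$ whose union is $X$. No separation axioms are assumed. Menger's property $\mathsf{S}_{\mathrm{fin}}(\mathrm{O},\mathrm{O})$: for each sequence $\mathcal{U}_1,\mathcal{U}_2,\dots$ of open covers of $X$ there are finite sets $\mathcal{F}_1\subseteq\mathcal{U}_1,\ \mathcal{F}_2\subseteq\mathcal{U}_2,\dots$ such that $\bigcup_n\mathcal{F}_n$ covers $X$. Menger's game $\mathsf{G}_{\mathrm{fin}}(\mathrm{O},\mathrm{O})$: a game for two players, Alice and Bob, with one inning for each natural number $n=1,2,\dots$. In inning $n$, Alice picks an open cover $\mathcal{U}_n$ of $X$, and then Bob selects a finite subset $\mathcal{F}_n\subseteq\mathcal{U}_n$. Bob wins the play if $\bigcup_n\mathcal{F}_n$ covers $X$; otherwise Alice wins. A strategy for Alice is a function assigning to each finite sequence (possibly empty) of previous legal moves of Bob the open cover that Alice plays next; it is winning if Alice wins every play in which she follows it. *)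

theory Defs
  imports "HOL-Analysis.Analysis"
begin

definition open_cover :: "'a topology \<Rightarrow> 'a set set \<Rightarrow> bool" where
  "open_cover X \<U> \<longleftrightarrow> (\<forall>U\<in>\<U>. openin X U) \<and> \<Union>\<U> = topspace X"

text \<open>Covers and innings are indexed by \<open>0, 1, 2, \<dots>\<close> rather than by \<open>1, 2, 3, \<dots>\<close>.\<close>

definition menger_property :: "'a topology \<Rightarrow> bool" where
  "menger_property X \<longleftrightarrow>
     (\<forall>\<U> :: nat \<Rightarrow> 'a set set. (\<forall>n. open_cover X (\<U> n)) \<longrightarrow>
        (\<exists>\<F> :: nat \<Rightarrow> 'a set set.
           (\<forall>n. finite (\<F> n) \<and> \<F> n \<subseteq> \<U> n) \<and> open_cover X (\<Union>n. \<F> n)))"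

definition menger_play ::
    "'a topology \<Rightarrow> (nat \<Rightarrow> 'a set set) \<Rightarrow> (nat \<Rightarrow> 'a set set) \<Rightarrow> bool" where
  "menger_play X \<U> \<F> \<longleftrightarrow>
     (\<forall>n. open_cover X (\<U> n) \<and> finite (\<F> n) \<and> \<F> n \<subseteq> \<U> n)"

definition bob_wins :: "'a topology \<Rightarrow> (nat \<Rightarrow> 'a set set) \<Rightarrow> bool" where
  "bob_wins X \<F> \<longleftrightarrow> open_cover X (\<Union>n. \<F> n)"

text \<open>A strategy \<open>\<sigma>\<close> is a total function on lists of Bob's moves, oldest move first, but only its
  values on legal lists matter: those whose \<open>i\<close>-th entry is a finite subset of the cover that
  \<open>\<sigma>\<close> plays after the first \<open>i\<close> entries.\<close>

definition legal_bob_moves :: "('a set set list \<Rightarrow> 'a set set) \<Rightarrow> 'a set set list \<Rightarrow> bool" where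
  "legal_bob_moves \<sigma> ms \<longleftrightarrow>
     (\<forall>i<length ms. finite (ms ! i) \<and> ms ! i \<subseteq> \<sigma> (take i ms))"

definition alice_strategy :: "'a topology \<Rightarrow> ('a set set list \<Rightarrow> 'a set set) \<Rightarrow> bool" where
  "alice_strategy X \<sigma> \<longleftrightarrow> (\<forall>ms. legal_bob_moves \<sigma> ms \<longrightarrow> open_cover X (\<sigma> ms))"

definition alice_follows ::
    "('a set set list \<Rightarrow> 'a set set) \<Rightarrow> (nat \<Rightarrow> 'a set set) \<Rightarrow> (nat \<Rightarrow> 'a set set) \<Rightarrow> bool" where
  "alice_follows \<sigma> \<U> \<F> \<longleftrightarrow> (\<forall>n. \<U> n = \<sigma> (map \<F> [0..<n]))"

definition alice_winning_strategy ::
    "'a topology \<Rightarrow> ('a set set list \<Rightarrow> 'a set set) \<Rightarrow> bool" where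
  "alice_winning_strategy X \<sigma> \<longleftrightarrow> alice_strategy X \<sigma> \<and>
     (\<forall>\<U> \<F>. menger_play X \<U> \<F> \<and> alice_follows \<sigma> \<U> \<F> \<longrightarrow> \<not> bob_wins X \<F>)"

end

(* By Menger's property every cover Alice plays is exhausted by an increasing sequence of finite
   subfamilies, so Bob may restrict his moves to these and a play is described by a sequence f of
   natural numbers; U s k denotes the union of the family with index k, played after the indices s.
   For a list h let W h be the set of points lying in U s (h ! i) for all i and all lists s of length i
   bounded pointwise by h. The W h with h of a fixed length form an open cover. Menger's property,
   applied to these covers, yields f such that each point x lies in some W h with h ! n \<le> f n for
   n the last position of h. At the least i with h ! i \<le> f i the initial segment of f is bounded
   by h, so x is covered in inning i. *)

theory Submission
  imports Defs
begin

text \<open>Finiteness serves twice below: it keeps a finite intersection of open sets open, and it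
  lets a single index work for all bounded histories at once.\<close>

lemma finite_list_all2_le:
  fixes h :: "nat list"
  shows "finite {s. list_all2 (\<le>) s h}"
proof (induction h)
  case Nil
  then show ?case by simp
next
  case (Cons a h)
  have "{s. list_all2 (\<le>) s (a # h)} = (\<lambda>(k, s). k # s) ` ({..a} \<times> {s. list_all2 (\<le>) s h})"
    by (auto simp: list_all2_Cons2)
  with Cons show ?case by simp
qed

text \<open>Menger's property for the constant sequence \<open>\<U>\<close> yields countably many
  finite selections; their partial unions are increasing.\<close>

lemma menger_property_finite_exhaustion:
  assumes X: "menger_property X" and \<U>: "open_cover X \<U>"
  obtains E :: "nat \<Rightarrow> 'a set set"
  where "\<And>k. finite (E k)" "\<And>k. E k \<subseteq> \<U>" "mono E" "(\<Union>k. \<Union>(E k)) = topspace X"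
proof -
  obtain F :: "nat \<Rightarrow> 'a set set"
    where F: "\<And>n. finite (F n)" "\<And>n. F n \<subseteq> \<U>" "open_cover X (\<Union>n. F n)"
    using X[unfolded menger_property_def, rule_format, of "\<lambda>_. \<U>"] \<U> by auto
  show thesis
  proof (rule that[of "\<lambda>k. \<Union>j\<le>k. F j"])
    show "mono (\<lambda>k. \<Union>j\<le>k. F j)"
      by (rule monoI) (meson UN_mono atMost_subset_iff order_refl)
    show "(\<Union>k. \<Union>(\<Union>j\<le>k. F j)) = topspace X"
      using F(3) unfolding open_cover_def by blast
  qed (use F in auto)
qed

lemma menger_property_tree:
  fixes U :: "nat list \<Rightarrow> nat \<Rightarrow> 'a set"
  assumes X: "menger_property X"
    and op: "\<And>s k. openin X (U s k)"
    and mono: "\<And>s. mono (U s)"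
    and cover: "\<And>s. (\<Union>k. U s k) = topspace X"
  obtains f where "\<And>x. x \<in> topspace X \<Longrightarrow> \<exists>n. x \<in> U (map f [0..<n]) (f n)"
proof -
  define W where "W h = {x \<in> topspace X. \<forall>i<length h. \<forall>s.
    list_all2 (\<le>) s (take i h) \<longrightarrow> x \<in> U s (h ! i)}" for h
  have W_Nil: "W [] = topspace X"
    by (simp add: W_def)
  \<comment> \<open>Appending \<open>k\<close> adds only the condition at position
    \<open>length h\<close>, where the bounding list is all of \<open>h\<close>.\<close>
  have W_snoc: "W (h @ [k]) = W h \<inter> (\<Inter>s\<in>{s. list_all2 (\<le>) s h}. U s k)" for h k
    unfolding W_def by (auto simp: less_Suc_eq nth_append)
  have op_W: "openin X (W h)" for h
  proof (induction h rule: rev_induct)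
    case Nil
    then show ?case by (simp add: W_Nil)
  next
    case (snoc k h)
    \<comment> \<open>An empty intersection would be \<open>UNIV\<close>, which need not be open in
      \<open>X\<close>; \<open>h\<close> bounds itself.\<close>
    have "{s. list_all2 (\<le>) s h} \<noteq> {}"
      using list_all2_refl[of "(\<le>)" h] by auto
    then have "openin X (\<Inter>s\<in>{s. list_all2 (\<le>) s h}. U s k)"
      by (intro openin_INT2 finite_list_all2_le op)
    with snoc show ?case
      by (simp only: W_snoc openin_Int)
  qed
  have ex_W: "\<exists>h. length h = n \<and> x \<in> W h" if x: "x \<in> topspace X" for x n
  proof (induction n)
    case 0
    then show ?case using x by (auto simp: W_Nil)
  next
    case (Suc n)
    then obtain h where h: "length h = n" "x \<in> W h" by blast
    \<comment> \<open>Monotonicity upgrades some \<open>k\<close> to all large \<open>k\<close>, so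
      finitely many \<open>s\<close> admit a common one.\<close>
    have "\<forall>\<^sub>F k in sequentially. x \<in> U s k" for s
    proof -
      obtain k where "x \<in> U s k" using x cover[of s] by blast
      then show ?thesis
        unfolding eventually_sequentially using monoD[OF mono[of s]] by blast
    qed
    then have "\<forall>\<^sub>F k in sequentially. \<forall>s\<in>{s. list_all2 (\<le>) s h}. x \<in> U s k"
      by (intro eventually_ball_finite finite_list_all2_le ballI)
    then obtain k where "\<forall>s\<in>{s. list_all2 (\<le>) s h}. x \<in> U s k"
      using eventually_happens' sequentially_bot by blast
    with h have "length (h @ [k]) = Suc n \<and> x \<in> W (h @ [k])"
      by (auto simp: W_snoc)
    then show ?case by blast
  qed
  \<comment> \<open>Length \<open>Suc n\<close> rather than \<open>n\<close>, so that the entry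
    \<open>h ! n\<close> exists.\<close>
  have "open_cover X (W ` {h. length h = Suc n})" for n
    unfolding open_cover_def using op_W openin_subset[OF op_W] ex_W[of _ "Suc n"] by blast
  then have "\<exists>F. (\<forall>n. finite (F n) \<and> F n \<subseteq> W ` {h. length h = Suc n}) \<and> open_cover X (\<Union>n. F n)"
    using X[unfolded menger_property_def, rule_format, of "\<lambda>n. W ` {h. length h = Suc n}"] by simp
  then obtain F where F: "\<And>n. finite (F n)" "\<And>n. F n \<subseteq> W ` {h. length h = Suc n}"
    "open_cover X (\<Union>n. F n)"
    by metis
  have "\<exists>H \<subseteq> {h. length h = Suc n}. finite H \<and> F n = W ` H" for n
    using F(1,2) by (rule finite_subset_image)
  then obtain H where H: "\<And>n. H n \<subseteq> {h. length h = Suc n}" "\<And>n. finite (H n)"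
    "\<And>n. F n = W ` H n"
    by metis
  \<comment> \<open>The inserted 0 keeps \<open>Max\<close> defined when \<open>H n\<close> is
    empty.\<close>
  define f where "f n = Max (insert 0 ((\<lambda>h. h ! n) ` H n))" for n
  have f: "h ! n \<le> f n" if "h \<in> H n" for h n
    unfolding f_def using H(2) that by (intro Max_ge) auto
  show thesis
  proof (rule that[of f])
    fix x assume "x \<in> topspace X"
    then have "x \<in> \<Union>(\<Union>n. W ` H n)"
      using F(3) by (simp add: open_cover_def H(3))
    then obtain n h where h: "h \<in> H n" "x \<in> W h"
      by blast
    \<comment> \<open>Since \<open>h ! n \<le> f n\<close>, this least index exists and is at most
      \<open>n\<close>; by minimality \<open>f j < h ! j\<close> for all
      \<open>j < i\<close>.\<close>
    define i where "i = (LEAST i. h ! i \<le> f i)"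
    have i: "h ! i \<le> f i" "i \<le> n"
      unfolding i_def using f[OF h(1)] by (rule LeastI, rule Least_le)
    have len: "length h = Suc n" using H(1) h(1) by blast
    have "f j \<le> h ! j" if "j < i" for j
      using not_less_Least[of j "\<lambda>i. h ! i \<le> f i"] that unfolding i_def by simp
    then have "list_all2 (\<le>) (map f [0..<i]) (take i h)"
      using i(2) len by (simp add: list_all2_conv_all_nth)
    with h(2) i(2) len have "x \<in> U (map f [0..<i]) (h ! i)"
      by (simp add: W_def)
    with i(1) show "\<exists>n. x \<in> U (map f [0..<n]) (f n)"
      using monoD[OF mono] by blast
  qed
qed

theorem theorem1:
  fixes X :: "'a topology"
  assumes "menger_property X"
  shows "\<not> (\<exists>\<sigma>. alice_winning_strategy X \<sigma>)"
proof
  assume "\<exists>\<sigma>. alice_winning_strategy X \<sigma>"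
  then obtain \<sigma> where strategy: "alice_strategy X \<sigma>"
    and winning: "\<And>\<U> \<F>. menger_play X \<U> \<F> \<Longrightarrow> alice_follows \<sigma> \<U> \<F> \<Longrightarrow> \<not> bob_wins X \<F>"
    unfolding alice_winning_strategy_def by blast
  \<comment> \<open>With the implication under the quantifier, one total choice function
    \<open>E\<close> handles all covers.\<close>
  have "\<forall>\<U>. \<exists>E :: nat \<Rightarrow> 'a set set. open_cover X \<U> \<longrightarrow>
      (\<forall>k. finite (E k) \<and> E k \<subseteq> \<U>) \<and> mono E \<and> (\<Union>k. \<Union>(E k)) = topspace X"
    using menger_property_finite_exhaustion[OF assms] by metis
  then obtain E :: "'a set set \<Rightarrow> nat \<Rightarrow> 'a set set" where E:
    "\<And>\<U> k. open_cover X \<U> \<Longrightarrow> finite (E \<U> k)"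
    "\<And>\<U> k. open_cover X \<U> \<Longrightarrow> E \<U> k \<subseteq> \<U>"
    "\<And>\<U>. open_cover X \<U> \<Longrightarrow> mono (E \<U>)"
    "\<And>\<U>. open_cover X \<U> \<Longrightarrow> (\<Union>k. \<Union>(E \<U> k)) = topspace X"
    by metis
  \<comment> \<open>\<open>B\<close> translates a list of indices into Bob's moves, each chosen from
    the cover that \<open>\<sigma>\<close> plays after the moves already made.\<close>
  define B where "B = foldl (\<lambda>ms k. ms @ [E (\<sigma> ms) k]) []"
  have B_Nil: "B [] = []" and B_snoc: "B (s @ [k]) = B s @ [E (\<sigma> (B s)) k]" for s k
    by (simp_all add: B_def)
  \<comment> \<open>Legality comes by induction: \<open>\<sigma>\<close> is known to give a cover
    only after legal moves, and \<open>E\<close> to give a legal move only from a cover.\<close>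
  have "legal_bob_moves \<sigma> (B s)" for s
  proof (induction s rule: rev_induct)
    case Nil
    then show ?case by (simp add: B_Nil legal_bob_moves_def)
  next
    case (snoc k s)
    then have "open_cover X (\<sigma> (B s))"
      using strategy by (simp add: alice_strategy_def)
    with snoc show ?case
      using E(1,2) by (simp add: B_snoc legal_bob_moves_def less_Suc_eq nth_append all_conj_distrib)
  qed
  then have oc: "open_cover X (\<sigma> (B s))" for s
    using strategy by (simp add: alice_strategy_def)
  obtain f where f: "\<And>x. x \<in> topspace X \<Longrightarrow> \<exists>n. x \<in> \<Union>(E (\<sigma> (B (map f [0..<n]))) (f n))"
  proof (rule menger_property_tree[OF assms, of "\<lambda>s k. \<Union>(E (\<sigma> (B s)) k)"])
    show "openin X (\<Union>(E (\<sigma> (B s)) k))" for s k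
      using oc E(2)[OF oc] unfolding open_cover_def by (intro openin_Union) blast
    show "mono (\<lambda>k. \<Union>(E (\<sigma> (B s)) k))" for s
      using E(3)[OF oc] by (intro monoI Union_mono) (rule monoD)
  qed (use E(4)[OF oc] in auto)
  define \<F> where "\<F> n = E (\<sigma> (B (map f [0..<n]))) (f n)" for n
  have B_map: "B (map f [0..<n]) = map \<F> [0..<n]" for n
    by (induction n) (simp_all add: B_Nil B_snoc \<F>_def)
  define \<U> where "\<U> n = \<sigma> (map \<F> [0..<n])" for n
  have oc_\<U>: "open_cover X (\<U> n)" for n
    using oc[of "map f [0..<n]"] by (simp add: \<U>_def B_map)
  have \<F>_eq: "\<F> n = E (\<U> n) (f n)" for n
    by (simp add: \<F>_def \<U>_def flip: B_map)
  have play: "menger_play X \<U> \<F>"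
    unfolding menger_play_def using oc_\<U> E(1,2) by (simp add: \<F>_eq)
  have "openin X V \<and> V \<subseteq> topspace X" if "V \<in> \<F> n" for V n
    using play that openin_subset unfolding menger_play_def open_cover_def by blast
  moreover have "topspace X \<subseteq> \<Union>(\<Union>n. \<F> n)"
    using f unfolding \<F>_def by blast
  ultimately have "bob_wins X \<F>"
    unfolding bob_wins_def open_cover_def by blast
  moreover have "alice_follows \<sigma> \<U> \<F>"
    by (simp add: alice_follows_def \<U>_def)
  ultimately show False
    using winning play by blast
qed

end
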